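(* Let $G$ be a generalized group. If $G$ is isomorphic to a generalized subgroup of a slender generalized group, then $G$ is a slender generalized group.
   Context: A generalized group is a semigroup $G$ such that (1) for each $x\in G$ there is a unique element $e(x)\in G$ with $e(x)x=xe(x)=x$, and (2) for each $x\in G$ there is $y\in G$ with $xy=yx=e(x)$. A homomorphism of generalized groups is a map $f:G\to H$ with $f(ab)=f(a)f(b)$ for all $a,b\in G$; an isomorphism is a bijective homomorphism. A generalized subgroup of a generalized group is a nonempty subset which is itself a generalized group under the restricted operation. Let $\mathbb{N}=\{1,2,3,\ldots\}$. For $n\in\mathbb{N}$, $i_n\in\prod_{\mathbb{N}}\mathbb{Z}$ denotes the sequence with $i_n(n)=1$ and $i_n(k)=0$ for $k\neq n$. $\prod_{\mathbb{N}}^{g}\mathbb{Z}$ denotes the generalized group with underlying set $\prod_{\mathbb{N}}\mathbb{Z}$ and operation $*$ given by $(x*y)_k=x_k$ if $k\equiv 1 \pmod 3$, $(x*y)_k=y_k$ if $k\equiv 2\pmod 3$, and $(x*y)_k=x_k+y_k$ if $k\equiv 0\pmod 3$. A generalized group $G$ is a slender generalized group if for every homomorphism of generalized groups $h:\prod_{\mathbb{N}}^{g}\mathbb{Z}\to G$ the set $\{n\in\mathbb{N}\mid h(i_n)\neq e(h(i_n))\}$ is finite. *)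

theory Defs
  imports "HOL-Algebra.Congruence" "HOL-Library.FuncSet"
begin

(* The type monoid of HOL-Algebra carries a distinguished unit, which a generalized group
   does not have; hence a record with a carrier and an operation only. *)
record 'a gengroup = "'a partial_object" +
  gop :: "'a \<Rightarrow> 'a \<Rightarrow> 'a"  (infixl \<open>\<star>\<index>\<close> 70)

(* The element e(x); meaningful only where such an element is unique. *)
definition gunit :: "('a, 'm) gengroup_scheme \<Rightarrow> 'a \<Rightarrow> 'a"
  where "gunit G x =
    (THE e. e \<in> carrier G \<and> e \<star>\<^bsub>G\<^esub> x = x \<and> x \<star>\<^bsub>G\<^esub> e = x)"

locale generalized_group =
  fixes G (structure)
  assumes closed: "\<lbrakk>x \<in> carrier G; y \<in> carrier G\<rbrakk> \<Longrightarrow> x \<star> y \<in> carrier G"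
    and assoc: "\<lbrakk>x \<in> carrier G; y \<in> carrier G; z \<in> carrier G\<rbrakk>
      \<Longrightarrow> (x \<star> y) \<star> z = x \<star> (y \<star> z)"
    and unit_ex1: "x \<in> carrier G \<Longrightarrow> \<exists>!e. e \<in> carrier G \<and> e \<star> x = x \<and> x \<star> e = x"
    and inverse_ex: "x \<in> carrier G \<Longrightarrow>
      \<exists>y\<in>carrier G. x \<star> y = gunit G x \<and> y \<star> x = gunit G x"

definition gengroup_hom ::
    "('a, 'm) gengroup_scheme \<Rightarrow> ('b, 'n) gengroup_scheme \<Rightarrow> ('a \<Rightarrow> 'b) set"
  where "gengroup_hom G H =
    {f \<in> carrier G \<rightarrow> carrier H.
      \<forall>a\<in>carrier G. \<forall>b\<in>carrier G. f (a \<star>\<^bsub>G\<^esub> b) = f a \<star>\<^bsub>H\<^esub> f b}"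

definition gengroup_iso ::
    "('a, 'm) gengroup_scheme \<Rightarrow> ('b, 'n) gengroup_scheme \<Rightarrow> ('a \<Rightarrow> 'b) set"
  where "gengroup_iso G H =
    {f \<in> gengroup_hom G H. bij_betw f (carrier G) (carrier H)}"

definition generalized_subgroup :: "'a set \<Rightarrow> ('a, 'm) gengroup_scheme \<Rightarrow> bool"
  where "generalized_subgroup K G \<longleftrightarrow>
    K \<noteq> {} \<and> K \<subseteq> carrier G \<and> generalized_group (G\<lparr>carrier := K\<rparr>)"

(* Sequences are indexed by {1, 2, 3, ...}: they are functions on nat that are
   undefined at 0, so that equality of functions is equality of sequences. *)
definition gen_prod_int :: "(nat \<Rightarrow> int) gengroup"
  where "gen_prod_int =
    \<lparr>carrier = {1..} \<rightarrow>\<^sub>E UNIV,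
     gop = (\<lambda>x y. \<lambda>k\<in>{1..}.
       if k mod 3 = 1 then x k else if k mod 3 = 2 then y k else x k + y k)\<rparr>"

definition unit_seq :: "nat \<Rightarrow> nat \<Rightarrow> int"
  where "unit_seq n = (\<lambda>k\<in>{1..}. if k = n then 1 else 0)"

definition slender_generalized_group :: "('a, 'm) gengroup_scheme \<Rightarrow> bool"
  where "slender_generalized_group G \<longleftrightarrow>
    generalized_group G \<and>
    (\<forall>h\<in>gengroup_hom gen_prod_int G.
      finite {n\<in>{1..}. h (unit_seq n) \<noteq> gunit G (h (unit_seq n))})"

lemma unit_seq_in_carrier: "unit_seq n \<in> carrier gen_prod_int"
  by (simp add: unit_seq_def gen_prod_int_def)

lemma generalized_group_gen_prod_int: "generalized_group gen_prod_int"
proof -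
  let ?P = gen_prod_int
  have unit_iff: "e \<in> carrier ?P \<and> e \<star>\<^bsub>?P\<^esub> x = x \<and> x \<star>\<^bsub>?P\<^esub> e = x \<longleftrightarrow>
      e = (\<lambda>k\<in>{1..}. if k mod 3 = 0 then 0 else x k)" (is "_ \<longleftrightarrow> e = ?e x")
    if "x \<in> carrier ?P" for e x
  proof
    assume e: "e \<in> carrier ?P \<and> e \<star>\<^bsub>?P\<^esub> x = x \<and> x \<star>\<^bsub>?P\<^esub> e = x"
    show "e = ?e x"
    proof
      fix k
      have "(e \<star>\<^bsub>?P\<^esub> x) k = x k" "(x \<star>\<^bsub>?P\<^esub> e) k = x k" using e by simp_all
      moreover have "k mod 3 = 0 \<or> k mod 3 = 1 \<or> k mod 3 = 2" by linarith
      ultimately show "e k = ?e x k"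
        using e by (auto simp: gen_prod_int_def restrict_def PiE_def extensional_def split: if_splits)
    qed
  qed (use that in \<open>auto simp: gen_prod_int_def restrict_def PiE_def extensional_def fun_eq_iff\<close>)
  have unit: "gunit ?P x = ?e x" if "x \<in> carrier ?P" for x
    unfolding gunit_def unit_iff[OF that] by (rule the_eq_trivial)
  show ?thesis
  proof
    fix x assume x: "x \<in> carrier ?P"
    show "\<exists>!e. e \<in> carrier ?P \<and> e \<star>\<^bsub>?P\<^esub> x = x \<and> x \<star>\<^bsub>?P\<^esub> e = x"
      using unit_iff[OF x] by simp
    show "\<exists>y\<in>carrier ?P. x \<star>\<^bsub>?P\<^esub> y = gunit ?P x \<and> y \<star>\<^bsub>?P\<^esub> x = gunit ?P x"
      unfolding unit[OF x]
      by (rule bexI[of _ "\<lambda>k\<in>{1..}. if k mod 3 = 0 then - x k else x k"])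
        (auto simp: gen_prod_int_def restrict_def PiE_def extensional_def fun_eq_iff)
  qed (auto simp: gen_prod_int_def restrict_def PiE_def extensional_def fun_eq_iff)
qed

end

theory Submission
  imports Defs
begin

text \<open>
  Slenderness only compares \<open>h (unit_seq n)\<close> with its own local unit, and an injective
  homomorphism \<open>f\<close> both preserves and reflects being a local unit. Hence a homomorphism \<open>h\<close> from
  the product into \<open>G\<close> and its composite with an embedding of \<open>G\<close> into \<open>H\<close> have the same set of
  exceptional indices, and slenderness of \<open>H\<close> makes that set finite. An isomorphism onto a
  generalized subgroup of \<open>H\<close> is such an embedding.
\<close>

context generalized_group
begin

lemma gunit_props:
  assumes "x \<in> carrier G"
  shows "gunit G x \<in> carrier G" "gunit G x \<star> x = x" "x \<star> gunit G x = x"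
  using theI'[OF unit_ex1[OF assms]] unfolding gunit_def by auto

lemma gunit_unique:
  assumes "x \<in> carrier G" "e \<in> carrier G" "e \<star> x = x" "x \<star> e = x"
  shows "gunit G x = e"
  using unit_ex1[OF assms(1)] gunit_props[OF assms(1)] assms(2-) by blast

end

lemma gengroup_hom_comp:
  assumes "h \<in> gengroup_hom P G" "f \<in> gengroup_hom G H"
  shows "f \<circ> h \<in> gengroup_hom P H"
  using assms unfolding gengroup_hom_def by (auto simp: Pi_iff)

text \<open>
  The image of \<open>gunit G x\<close> acts as a two-sided unit on \<open>f x\<close>, and local units in the
  codomain are unique.
\<close>

lemma gengroup_hom_gunit:
  assumes "generalized_group G" "generalized_group H"
    and f: "f \<in> gengroup_hom G H" and x: "x \<in> carrier G"
  shows "f (gunit G x) = gunit H (f x)"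
proof -
  interpret G: generalized_group G by fact
  interpret H: generalized_group H by fact
  note u = G.gunit_props[OF x]
  have mult: "f (a \<star>\<^bsub>G\<^esub> b) = f a \<star>\<^bsub>H\<^esub> f b" if "a \<in> carrier G" "b \<in> carrier G" for a b
    using f that by (simp add: gengroup_hom_def)
  have "f x \<in> carrier H" "f (gunit G x) \<in> carrier H"
    using f x u(1) by (auto simp: gengroup_hom_def)
  moreover have "f (gunit G x) \<star>\<^bsub>H\<^esub> f x = f x" "f x \<star>\<^bsub>H\<^esub> f (gunit G x) = f x"
    using mult[OF u(1) x] mult[OF x u(1)] u(2,3) by simp_all
  ultimately show ?thesis
    using H.gunit_unique by simp
qed

lemma slender_if_embeds:
  assumes G: "generalized_group G" and H: "slender_generalized_group H"
    and f: "f \<in> gengroup_hom G H" and inj: "inj_on f (carrier G)"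
  shows "slender_generalized_group G"
  unfolding slender_generalized_group_def
proof (intro conjI ballI)
  fix h assume h: "h \<in> gengroup_hom gen_prod_int G"
  have H': "generalized_group H"
    using H by (simp add: slender_generalized_group_def)
  have hu: "h (unit_seq n) \<in> carrier G" for n
    using h unit_seq_in_carrier by (auto simp: gengroup_hom_def)
  have "(f \<circ> h) (unit_seq n) = gunit H ((f \<circ> h) (unit_seq n))
      \<longleftrightarrow> h (unit_seq n) = gunit G (h (unit_seq n))" for n
    using inj_on_eq_iff[OF inj hu generalized_group.gunit_props(1)[OF G hu]]
      gengroup_hom_gunit[OF G H' f hu] by simp
  moreover have "finite {n\<in>{1..}. (f \<circ> h) (unit_seq n) \<noteq> gunit H ((f \<circ> h) (unit_seq n))}"
    using H gengroup_hom_comp[OF h f] unfolding slender_generalized_group_def by blast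
  ultimately show "finite {n\<in>{1..}. h (unit_seq n) \<noteq> gunit G (h (unit_seq n))}"
    by simp
qed (fact G)

theorem proposition1p7:
  fixes G :: "('a, 'm) gengroup_scheme" and H :: "('b, 'n) gengroup_scheme"
  assumes "generalized_group G"
    and "slender_generalized_group H"
    and "generalized_subgroup K H"
    and "f \<in> gengroup_iso G (H\<lparr>carrier := K\<rparr>)"
  shows "slender_generalized_group G"
proof (rule slender_if_embeds[OF assms(1,2)])
  show "f \<in> gengroup_hom G H"
    using assms(3,4) by (auto simp: gengroup_iso_def gengroup_hom_def generalized_subgroup_def)
  show "inj_on f (carrier G)"
    using assms(4) by (auto simp: gengroup_iso_def bij_betw_def)
qed

end
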